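(* Let $\alpha=\frac{1+\sqrt5}{2}$ and $\beta=\frac{1-\sqrt5}{2}$. Then the quintic theta functions satisfy $$C^5(q)=B^5(q)-\alpha^5A^5(q),\qquad D^5(q)=B^5(q)-\beta^5A^5(q),$$ $$C(q)=B(q^5)-\alpha A(q^5),\qquad D(q)=B(q^5)-\beta A(q^5).$$
   Context: $q=e^{2\pi i\tau}$ with $\operatorname{Im}\tau>0$ (so $|q|<1$), and fractional powers mean $q^{r}=e^{2\pi i r\tau}$; in particular $A(q^5)$ is obtained from $A(q)$ by $\tau\mapsto5\tau$, so $(q^5)^{1/5}=q$. Notation: $(a;q)_\infty=\prod_{k\ge0}(1-aq^k)$, and $(q;q)_\infty^{s}$ for fractional $s$ denotes the branch whose power series has constant term $1$. The quintic theta functions are $$A(q)=q^{1/5}(q;q)_\infty^{-3/5}\sum_{n=-\infty}^{\infty}(-1)^nq^{(5n^2-3n)/2},\qquad B(q)=(q;q)_\infty^{-3/5}\sum_{n=-\infty}^{\infty}(-1)^nq^{(5n^2-n)/2},$$ $$C(q)=\frac{(q^5;q^5)_\infty^{-3/5}}{1+e^{3\pi i/5}}\sum_{n=-\infty}^{\infty}e^{3\pi in/5}q^{(n^2-n)/2},\qquad D(q)=\frac{(q^5;q^5)_\infty^{-3/5}}{1+e^{\pi i/5}}\sum_{n=-\infty}^{\infty}e^{\pi in/5}q^{(n^2-n)/2}.$$ *)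

theory Defs
  imports "HOL-Complex_Analysis.Complex_Analysis"
begin

text \<open>
  All functions of \<open>q = exp (2 * pi * \<i> * \<tau>)\<close> with fractional powers of \<open>q\<close> are functions of
  \<open>\<tau>\<close> with \<open>Im \<tau> > 0\<close>; \<open>q_power \<tau> r\<close> is \<open>q\<close> to the power \<open>r\<close>. Replacing \<open>q\<close> by the fifth
  power of \<open>q\<close> means replacing \<open>\<tau>\<close> by \<open>5 * \<tau>\<close>.
\<close>

definition q_power :: "complex \<Rightarrow> real \<Rightarrow> complex" where
  "q_power \<tau> r = exp (2 * of_real pi * \<i> * of_real r * \<tau>)"

definition qpochhammer_inf :: "complex \<Rightarrow> complex \<Rightarrow> complex" where
  "qpochhammer_inf a q = (\<Prod>k. 1 - a * q ^ k)"

text \<open>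
  The \<open>s\<close>-th power of \<open>qpochhammer_inf q q\<close> for fractional \<open>s\<close>, on the branch with value \<open>1\<close> at
  \<open>q = 0\<close>, is \<open>exp (s * L q)\<close> where \<open>L\<close> is the holomorphic logarithm of \<open>qpochhammer_inf q q\<close>
  on the unit disc with \<open>L 0 = 0\<close>. That \<open>log_euler\<close> is this \<open>L\<close> is the content of
  \<open>exp_log_euler\<close>, \<open>log_euler_holomorphic\<close> and \<open>log_euler_0\<close> below.
\<close>

definition log_euler :: "complex \<Rightarrow> complex" where
  "log_euler q = (\<Sum>k. Ln (1 - q ^ Suc k))"

definition euler_powr :: "complex \<Rightarrow> real \<Rightarrow> complex" where
  "euler_powr q s = exp (of_real s * log_euler q)"

definition theta_A :: "complex \<Rightarrow> complex" where
  "theta_A \<tau> = q_power \<tau> (1/5) * euler_powr (q_power \<tau> 1) (-3/5) *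
     (\<Sum>\<^sub>\<infinity>n::int. (-1) powi n * q_power \<tau> ((5 * of_int n ^ 2 - 3 * of_int n) / 2))"

definition theta_B :: "complex \<Rightarrow> complex" where
  "theta_B \<tau> = euler_powr (q_power \<tau> 1) (-3/5) *
     (\<Sum>\<^sub>\<infinity>n::int. (-1) powi n * q_power \<tau> ((5 * of_int n ^ 2 - of_int n) / 2))"

definition theta_C :: "complex \<Rightarrow> complex" where
  "theta_C \<tau> = euler_powr (q_power \<tau> 5) (-3/5) / (1 + exp (3 * of_real pi * \<i> / 5)) *
     (\<Sum>\<^sub>\<infinity>n::int. exp (3 * of_real pi * \<i> * of_int n / 5) *
        q_power \<tau> ((of_int n ^ 2 - of_int n) / 2))"

definition theta_D :: "complex \<Rightarrow> complex" where
  "theta_D \<tau> = euler_powr (q_power \<tau> 5) (-3/5) / (1 + exp (of_real pi * \<i> / 5)) *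
     (\<Sum>\<^sub>\<infinity>n::int. exp (of_real pi * \<i> * of_int n / 5) *
        q_power \<tau> ((of_int n ^ 2 - of_int n) / 2))"

lemma log_euler_0: "log_euler 0 = 0"
  by (simp add: log_euler_def)

lemma norm_Ln_euler_factor_le:
  fixes r :: real
  assumes "0 \<le> r" "r < 1"
  shows "eventually (\<lambda>k. \<forall>q\<in>cball 0 r. norm (Ln (1 - q ^ Suc k)) \<le> 2 * r ^ Suc k) sequentially"
proof -
  have "(\<lambda>k. r ^ Suc k) \<longlonglongrightarrow> 0"
    using assms by (intro LIMSEQ_Suc LIMSEQ_power_zero) auto
  hence "eventually (\<lambda>k. r ^ Suc k < 1/2) sequentially"
    by (rule order_tendstoD) simp
  thus ?thesis
  proof eventually_elim
    case (elim k)
    show ?case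
    proof
      fix q :: complex assume "q \<in> cball 0 r"
      hence le: "norm (q ^ Suc k) \<le> r ^ Suc k"
        by (simp only: norm_power) (intro power_mono, auto)
      have "norm (Ln (1 + - (q ^ Suc k))) \<le> 2 * norm (- (q ^ Suc k))"
        by (rule norm_Ln_le) (use le elim in \<open>simp only: norm_minus_cancel\<close>)
      also have "\<dots> \<le> 2 * r ^ Suc k"
        using le by (simp only: norm_minus_cancel)
      finally show "norm (Ln (1 - q ^ Suc k)) \<le> 2 * r ^ Suc k"
        by simp
    qed
  qed
qed

lemma summable_two_geometric:
  fixes r :: real
  assumes "0 \<le> r" "r < 1"
  shows "summable (\<lambda>k. 2 * r ^ Suc k)"
proof -
  have "summable (\<lambda>k. (2 * r) * r ^ k)"
    using assms by (intro summable_mult summable_geometric) auto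
  thus ?thesis by (simp add: mult.assoc)
qed

lemma summable_log_euler:
  assumes "norm q < 1"
  shows "summable (\<lambda>k. Ln (1 - q ^ Suc k))"
proof (rule summable_comparison_test_ev)
  show "eventually (\<lambda>k. norm (Ln (1 - q ^ Suc k)) \<le> 2 * norm q ^ Suc k) sequentially"
    using norm_Ln_euler_factor_le[of "norm q"] assms by (auto elim!: eventually_mono)
  show "summable (\<lambda>k. 2 * norm q ^ Suc k)"
    using assms by (intro summable_two_geometric) auto
qed

lemma power_Suc_norm_less_1:
  fixes q :: complex
  assumes "norm q < 1"
  shows "norm (q ^ Suc k) < 1"
  unfolding norm_power using assms by (simp only: power_less_one_iff norm_ge_zero)  simp

lemma exp_log_euler:
  assumes "norm q < 1"
  shows "exp (log_euler q) = qpochhammer_inf q q"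
proof -
  have "exp (Ln (1 - q ^ Suc k)) = 1 - q * q ^ k" for k
    using power_Suc_norm_less_1[OF assms, of k] by (subst exp_Ln) auto
  thus ?thesis
    using prodinf_exp[OF summable_log_euler[OF assms]]
    by (simp add: log_euler_def qpochhammer_inf_def)
qed

lemma log_euler_holomorphic: "log_euler holomorphic_on ball 0 1"
proof (rule holomorphic_uniform_sequence)
  show "open (ball 0 1 :: complex set)" by simp
  show "(\<lambda>q. \<Sum>k<n. Ln (1 - q ^ Suc k)) holomorphic_on ball 0 1" for n
  proof (intro holomorphic_intros)
    fix q :: complex and k :: nat
    assume "q \<in> ball 0 1"
    hence "norm (q ^ Suc k) < 1"
      by (intro power_Suc_norm_less_1) auto
    hence "Re (1 - q ^ Suc k) > 0"
      using complex_Re_le_cmod[of "q ^ Suc k"] by simp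
    thus "1 - q ^ Suc k \<notin> \<real>\<^sub>\<le>\<^sub>0"
      by (auto simp: complex_nonpos_Reals_iff)
  qed
  fix x :: complex assume x: "x \<in> ball 0 1"
  define d where "d = (1 - norm x) / 2"
  have d: "d > 0" "norm x + d < 1"
    using x by (auto simp: d_def field_simps)
  have sub: "cball x d \<subseteq> cball 0 (norm x + d)"
    by (intro cball_subset_cball_iff[THEN iffD2]) (auto simp: dist_norm)
  have "uniform_limit (cball 0 (norm x + d)) (\<lambda>n q. \<Sum>k<n. Ln (1 - q ^ Suc k))
          (\<lambda>q. \<Sum>k. Ln (1 - q ^ Suc k)) sequentially"
    by (rule Weierstrass_m_test_ev[OF norm_Ln_euler_factor_le summable_two_geometric])
       (use d in auto)
  hence "uniform_limit (cball x d) (\<lambda>n q. \<Sum>k<n. Ln (1 - q ^ Suc k)) log_euler sequentially"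
    unfolding log_euler_def by (rule uniform_limit_on_subset[OF _ sub])
  moreover have "cball x d \<subseteq> ball 0 1"
    using sub d by (force simp: subset_iff)
  ultimately show "\<exists>d. 0 < d \<and> cball x d \<subseteq> ball 0 1 \<and>
      uniform_limit (cball x d) (\<lambda>n q. \<Sum>k<n. Ln (1 - q ^ Suc k)) log_euler sequentially"
    using d by blast
qed

end

theory Submission
  imports Defs
begin

text \<open>
  Both \<open>C\<close> and \<open>D\<close> have the form \<open>Q \<zeta> \<tau>\<close> with \<open>\<zeta> ^ 5 = -1\<close>. Splitting the series of
  \<open>Q \<zeta> \<tau>\<close> according to \<open>n mod 5\<close> gives \<open>Q \<zeta> \<tau> = B (5 \<tau>) + u A (5 \<tau>)\<close> with
  \<open>u = \<zeta> + 1 / \<zeta> - 1\<close>, and \<open>u\<close> is \<open>- \<alpha>\<close> or \<open>- \<beta>\<close>.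
  Since \<open>B (\<tau> + 1) = B \<tau>\<close> and \<open>A (\<tau> + 1) = \<omega> A \<tau>\<close> with \<open>\<omega> = exp (2 \<pi> \<i> / 5)\<close>, multiplying this
  identity over the points \<open>(\<tau> + j) / 5\<close> for \<open>j < 5\<close> yields \<open>B \<tau> ^ 5 + u ^ 5 A \<tau> ^ 5\<close>. On the other
  hand \<open>Q\<close> is an infinite product by Jacobi's triple product identity, and the product of its values
  at these five points collapses to \<open>Q \<zeta> \<tau> ^ 5\<close>, because the product over \<open>j\<close> of
  \<open>1 - \<omega> ^ (j k) x\<close> is \<open>1 - x ^ 5\<close> if \<open>5\<close> does not divide \<open>k\<close>, and \<open>(1 - x) ^ 5\<close> otherwise.
\<close>

subsection \<open>The Jacobi triple product\<close>

definition qpochhammer :: "complex \<Rightarrow> complex \<Rightarrow> nat \<Rightarrow> complex" where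
  "qpochhammer a q n = (\<Prod>k<n. 1 - a * q ^ k)"

lemma qpochhammer_0 [simp]: "qpochhammer a q 0 = 1"
  by (simp add: qpochhammer_def)

lemma qpochhammer_Suc: "qpochhammer a q (Suc n) = qpochhammer a q n * (1 - a * q ^ n)"
  by (simp add: qpochhammer_def)

lemma qpochhammer_rec: "qpochhammer a q (Suc n) = (1 - a) * qpochhammer (a * q) q n"
  by (simp add: qpochhammer_def prod.lessThan_Suc_shift mult.assoc del: prod.lessThan_Suc)

lemma qpochhammer_tendsto:
  assumes "norm q < 1"
  shows "qpochhammer a q \<longlonglongrightarrow> qpochhammer_inf a q"
proof -
  have "abs_convergent_prod (\<lambda>k. 1 + - (a * q ^ k))"
    using assms
    by (intro summable_imp_abs_convergent_prod)
       (auto simp: norm_mult norm_power intro!: summable_mult summable_geometric)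
  hence "(\<lambda>n. \<Prod>k\<le>n. 1 - a * q ^ k) \<longlonglongrightarrow> qpochhammer_inf a q"
    unfolding qpochhammer_inf_def
    by (intro convergent_prod_LIMSEQ) (auto dest: abs_convergent_prod_imp_convergent_prod)
  hence "(\<lambda>n. qpochhammer a q (Suc n)) \<longlonglongrightarrow> qpochhammer_inf a q"
    by (simp only: qpochhammer_def lessThan_Suc_atMost)
  thus ?thesis
    by (rule LIMSEQ_imp_Suc)
qed

lemma qpochhammer_inf_rec:
  assumes "norm q < 1"
  shows "qpochhammer_inf a q = (1 - a) * qpochhammer_inf (a * q) q"
proof (rule LIMSEQ_unique)
  show "(\<lambda>n. qpochhammer a q (Suc n)) \<longlonglongrightarrow> qpochhammer_inf a q"
    by (rule LIMSEQ_Suc[OF qpochhammer_tendsto[OF assms]])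
  show "(\<lambda>n. qpochhammer a q (Suc n)) \<longlonglongrightarrow> (1 - a) * qpochhammer_inf (a * q) q"
    unfolding qpochhammer_rec by (intro tendsto_intros qpochhammer_tendsto assms)
qed

lemma qpochhammer_self_nonzero:
  assumes "norm q < 1"
  shows "qpochhammer q q n \<noteq> 0"
proof -
  have "1 - q * q ^ k \<noteq> 0" for k
    using power_Suc_norm_less_1[OF assms, of k] by auto
  thus ?thesis
    by (simp add: qpochhammer_def)
qed

lemma qpochhammer_inf_self_nonzero:
  assumes "norm q < 1"
  shows "qpochhammer_inf q q \<noteq> 0"
  using exp_log_euler[OF assms] by (metis exp_not_eq_zero)

section \<open>Gaussian binomial coefficients and the \<open>q\<close>-binomial theorem\<close>

text \<open>The Gaussian binomial coefficient, meaningful only for \<open>k \<le> n\<close>: beyond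
  that range \<open>n - k\<close> truncates to \<open>0\<close> and the quotient does not vanish.
  Hence the Pascal rule below assumes \<open>k < n\<close>, and sums treat their end terms
  separately.\<close>

definition qbinomial :: "complex \<Rightarrow> nat \<Rightarrow> nat \<Rightarrow> complex" where
  "qbinomial q n k = qpochhammer q q n / (qpochhammer q q k * qpochhammer q q (n - k))"

lemma qbinomial_0 [simp]: "norm q < 1 \<Longrightarrow> qbinomial q n 0 = 1"
  by (simp add: qbinomial_def qpochhammer_self_nonzero)

lemma qbinomial_self [simp]: "norm q < 1 \<Longrightarrow> qbinomial q n n = 1"
  by (simp add: qbinomial_def qpochhammer_self_nonzero)

text \<open>One of the two \<open>q\<close>-Pascal rules. With \<open>n = k + d + 1\<close> and a
  common denominator it becomes
  \<open>1 - q^(n+1) = (1 - q^(d+1)) + q^(d+1) * (1 - q^(k+1))\<close>.\<close>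

lemma qbinomial_Suc:
  assumes "norm q < 1" "k < n"
  shows "qbinomial q (Suc n) (Suc k) = qbinomial q n (Suc k) + q ^ (n - k) * qbinomial q n k"
proof -
  obtain d where n: "n = k + Suc d"
    using assms(2) by (metis add_Suc_right less_imp_Suc_add)
  define A B C where "A = qpochhammer q q n" and "B = qpochhammer q q k" and "C = qpochhammer q q d"
  have nz: "B \<noteq> 0" "C \<noteq> 0" "1 - q * q ^ k \<noteq> 0" "1 - q * q ^ d \<noteq> 0"
    using qpochhammer_self_nonzero[OF assms(1)] power_Suc_norm_less_1[OF assms(1)]
    by (auto simp: B_def C_def) (metis norm_one order_less_irrefl power_Suc)+
  have d: "Suc n - Suc k = Suc d" "n - Suc k = d" "n - k = Suc d"
    using n by auto
  have "qbinomial q (Suc n) (Suc k) = A * (1 - q * q ^ n) / (B * (1 - q * q ^ k) * (C * (1 - q * q ^ d)))"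
    "qbinomial q n (Suc k) = A / (B * (1 - q * q ^ k) * C)"
    "qbinomial q n k = A / (B * (C * (1 - q * q ^ d)))"
    by (simp_all add: qbinomial_def d qpochhammer_Suc A_def B_def C_def)
  moreover have "A * (1 - q * q ^ n) / (B * (1 - q * q ^ k) * (C * (1 - q * q ^ d))) =
      A / (B * (1 - q * q ^ k) * C) + q ^ (n - k) * (A / (B * (C * (1 - q * q ^ d))))"
    unfolding d n using nz by (simp add: divide_simps power_add) (simp add: algebra_simps)
  ultimately show ?thesis by simp
qed

lemma zero_choose_two [simp]: "0 choose 2 = 0"
  by (rule binomial_eq_0) simp

lemma Suc_choose_two: "Suc n choose 2 = n + (n choose 2)"
  by (simp add: numeral_2_eq_2)

theorem q_binomial_theorem:
  assumes "norm q < 1"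
  shows "qpochhammer (- x) q n = (\<Sum>k\<le>n. qbinomial q n k * q ^ (k choose 2) * x ^ k)"
proof (induction n)
  case (Suc n)
  let ?t = "\<lambda>n k. qbinomial q n k * q ^ (k choose 2) * x ^ k"
  \<comment> \<open>The power \<open>q ^ (n - k)\<close> from the Pascal rule and the
    \<open>q ^ k\<close> from \<open>Suc k choose 2\<close> merge into \<open>q ^ n\<close>, which
    is independent of \<open>k\<close> and so factors out of the sum.\<close>
  have step: "?t (Suc n) (Suc k) = ?t n (Suc k) + x * q ^ n * ?t n k" if "k < n" for k
  proof -
    have "q ^ (n - k) * q ^ k = q ^ n"
      using that by (simp flip: power_add)
    thus ?thesis
      unfolding qbinomial_Suc[OF assms that] Suc_choose_two
      by (simp add: algebra_simps power_add flip: \<open>_ = q ^ n\<close>)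
  qed
  have "(\<Sum>k\<le>Suc n. ?t (Suc n) k) = 1 + (\<Sum>k<n. ?t (Suc n) (Suc k)) + ?t (Suc n) (Suc n)"
    using assms by (subst sum.atMost_Suc_shift) (simp add: lessThan_Suc_atMost[symmetric])
  also have "\<dots> = (1 + (\<Sum>k<n. ?t n (Suc k))) + x * q ^ n * ((\<Sum>k<n. ?t n k) + ?t n n)"
  proof -
    have "(\<Sum>k<n. ?t (Suc n) (Suc k)) = (\<Sum>k<n. ?t n (Suc k) + x * q ^ n * ?t n k)"
      by (rule sum.cong[OF refl step]) simp
    moreover have "?t (Suc n) (Suc n) = x * q ^ n * ?t n n"
      using assms by (simp add: Suc_choose_two power_add)
    ultimately show ?thesis
      by (simp only: sum.distrib sum_distrib_left distrib_left add_ac)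
  qed
  also have "1 + (\<Sum>k<n. ?t n (Suc k)) = (\<Sum>k\<le>n. ?t n k)"
    using assms by (cases n) (simp_all add: sum.atMost_Suc_shift lessThan_Suc_atMost del: sum.atMost_Suc)
  also have "(\<Sum>k<n. ?t n k) + ?t n n = (\<Sum>k\<le>n. ?t n k)"
    by (simp add: lessThan_Suc_atMost[symmetric])
  finally show ?case
    using Suc.IH by (simp add: qpochhammer_Suc algebra_simps)
qed (use assms in \<open>simp\<close>)

section \<open>Convergence of series over the integers\<close>

text \<open>Dominated convergence for two-sided series. Enumerating the integers by
  \<open>int_decode\<close> gives ordinary series, to which Tannery's theorem applies; the majorant
  \<open>h\<close> makes every sum absolutely convergent, so the enumeration does not
  matter.\<close>

lemma tendsto_infsum_int:
  fixes f :: "nat \<Rightarrow> int \<Rightarrow> 'a :: {real_normed_algebra, banach}"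
  assumes lim: "\<And>j. (\<lambda>n. f n j) \<longlonglongrightarrow> g j"
    and le: "\<And>n j. norm (f n j) \<le> h j"
    and h: "h summable_on UNIV"
  shows "(\<lambda>n. \<Sum>\<^sub>\<infinity>j. f n j) \<longlonglongrightarrow> (\<Sum>\<^sub>\<infinity>j. g j)"
proof -
  have bij: "bij_betw int_decode UNIV UNIV"
    by (rule bij_int_decode)
  have h': "summable (\<lambda>k. h (int_decode k))"
    using h summable_on_reindex_bij_betw[OF bij, of h] by (auto intro: summable_on_imp_summable)
  have g_le: "norm (g j) \<le> h j" for j
    by (rule Lim_norm_ubound[OF _ lim]) (auto intro: le always_eventually)
  have eq: "infsum u UNIV = (\<Sum>k. u (int_decode k))" if "\<And>j. norm (u j) \<le> h j" for u :: "int \<Rightarrow> 'a"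
  proof -
    have "summable (\<lambda>k. norm (u (int_decode k)))"
      by (rule summable_comparison_test'[OF h']) (simp add: that)
    hence "((\<lambda>k. u (int_decode k)) has_sum (\<Sum>k. u (int_decode k))) UNIV"
      by (intro norm_summable_imp_has_sum) (auto intro: summable_sums summable_norm_cancel)
    thus ?thesis
      using infsum_reindex_bij_betw[OF bij, of u] by (simp add: infsumI)
  qed
  have "(\<lambda>n. \<Sum>k. f n (int_decode k)) \<longlonglongrightarrow> (\<Sum>k. g (int_decode k))"
    using tannerys_theorem[of "\<lambda>k n. f n (int_decode k)" "\<lambda>k. g (int_decode k)" sequentially
        "\<lambda>k. h (int_decode k)"] lim le h' by (auto intro: always_eventually)
  thus ?thesis
    by (simp add: eq le g_le)
qed

text \<open>The ratio of consecutive terms is \<open>x * y ^ n\<close>, which tends to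
  \<open>0\<close> however large \<open>x\<close> is.\<close>

lemma summable_triangular:
  fixes x y :: real
  assumes "0 \<le> x" "0 \<le> y" "y < 1"
  shows "summable (\<lambda>n. x ^ n * y ^ (n choose 2))"
proof -
  have "(\<lambda>n. x * y ^ n) \<longlonglongrightarrow> x * 0"
    using assms by (intro tendsto_intros LIMSEQ_power_zero) auto
  hence "eventually (\<lambda>n. x * y ^ n < 1 / 2) sequentially"
    by (rule order_tendstoD) simp
  then obtain N where N: "\<And>n. n \<ge> N \<Longrightarrow> x * y ^ n < 1 / 2"
    by (auto simp: eventually_at_top_linorder)
  show ?thesis
  proof (rule summable_ratio_test)
    fix n assume "n \<ge> N"
    have "norm (x ^ Suc n * y ^ (Suc n choose 2)) = (x * y ^ n) * norm (x ^ n * y ^ (n choose 2))"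
      using assms by (simp add: Suc_choose_two power_add)
    also have "\<dots> \<le> 1 / 2 * norm (x ^ n * y ^ (n choose 2))"
      using N[OF \<open>n \<ge> N\<close>] by (intro mult_right_mono) auto
    finally show "norm (x ^ Suc n * y ^ (Suc n choose 2)) \<le> 1 / 2 * norm (x ^ n * y ^ (n choose 2))" .
  qed simp
qed

section \<open>Theta series and their product form\<close>

text \<open>The general term of the two-sided theta series. Since \<open>n * (n - 1)\<close> is
  even, \<open>div\<close> is exact here.\<close>

definition theta_term :: "complex \<Rightarrow> complex \<Rightarrow> int \<Rightarrow> complex" where
  "theta_term z q n = z powi n * q powi (n * (n - 1) div 2)"

lemma theta_term_of_nat: "theta_term z q (int n) = z ^ n * q ^ (n choose 2)"
proof -
  have "int n * (int n - 1) div 2 = int (n choose 2)"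
    unfolding choose_two by (cases n) (simp_all add: zdiv_int algebra_simps)
  thus ?thesis
    by (simp add: theta_term_def)
qed

text \<open>Reflection of the index exchanges \<open>z\<close> and \<open>q / z\<close>, which
  reduces the negative half of the series to the nonnegative half.\<close>

lemma theta_term_minus:
  assumes "z \<noteq> 0" "q \<noteq> 0"
  shows "theta_term z q (- n) = theta_term (q / z) q n"
proof -
  have "- n * (- n - 1) = n * (n - 1) + n * 2"
    by (simp add: algebra_simps)
  hence "- n * (- n - 1) div 2 = n * (n - 1) div 2 + n"
    by (metis div_mult_self1 zero_neq_numeral add.commute)
  thus ?thesis
    using assms
    by (simp add: theta_term_def power_int_add power_int_divide_distrib power_int_minus field_simps)
qed

lemma theta_term_abs_summable:
  assumes "z \<noteq> 0" "q \<noteq> 0" "norm q < 1"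
  shows "(\<lambda>n. norm (theta_term z q n)) summable_on UNIV"
proof -
  have nonneg: "(\<lambda>n. norm (theta_term w q n)) summable_on range int" for w
  proof -
    have "(\<lambda>n. norm (theta_term w q (int n))) summable_on UNIV"
      using summable_triangular[of "norm w" "norm q"] assms(3)
      by (subst summable_on_UNIV_nonneg_real_iff)
         (simp_all add: theta_term_of_nat norm_mult norm_power)
    thus ?thesis
      by (subst summable_on_reindex) (simp_all add: o_def)
  qed
  have "(\<lambda>n. norm (theta_term z q (- n))) summable_on range int"
    using nonneg[of "q / z"] assms by (simp add: theta_term_minus)
  hence "(\<lambda>n. norm (theta_term z q n)) summable_on uminus ` range int"
    by (subst summable_on_reindex) (simp_all add: o_def)
  with nonneg[of z] have "(\<lambda>n. norm (theta_term z q n)) summable_on range int \<union> uminus ` range int"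
    by (rule summable_on_union)
  also have "range int \<union> uminus ` range int = UNIV"
    by (auto simp: image_iff) (metis int_cases2)
  finally show ?thesis .
qed

text \<open>The first \<open>n\<close> factors on the left are \<open>1 + z / q^k\<close> for
  \<open>k\<close> from \<open>1\<close> to \<open>n\<close>. Each equals
  \<open>(1 + q^k / z) * (z / q^k)\<close>, and the prefactors multiply to
  \<open>z^n / q^(n(n+1)/2)\<close>.\<close>

lemma qpochhammer_shift:
  assumes "z \<noteq> 0" "q \<noteq> 0"
  shows "qpochhammer (- (z / q ^ n)) q (n + N) =
           qpochhammer (- z) q N * qpochhammer (- (q / z)) q n * (z ^ n / q ^ (Suc n choose 2))"
proof (induction n)
  case (Suc n)
  have "- (z / q ^ Suc n) * q = - (z / q ^ n)"
    using assms by simp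
  hence "qpochhammer (- (z / q ^ Suc n)) q (Suc n + N) =
      (1 + z / q ^ Suc n) * qpochhammer (- (z / q ^ n)) q (n + N)"
    using qpochhammer_rec[of "- (z / q ^ Suc n)" q "n + N"] by simp
  also have "1 + z / q ^ Suc n = (1 + q / z * q ^ n) * (z / q ^ Suc n)"
    using assms by (simp add: field_simps)
  finally have eq: "qpochhammer (- (z / q ^ Suc n)) q (Suc n + N) =
      (1 + q / z * q ^ n) * (z / q ^ Suc n) * qpochhammer (- (z / q ^ n)) q (n + N)" .
  show ?case
    unfolding eq Suc.IH Suc_choose_two[of "Suc n"]
    by (simp add: qpochhammer_Suc power_add mult_ac)
qed (simp add: numeral_2_eq_2)

lemma two_times_choose_two: "2 * int (n choose 2) = int n * (int n - 1)"
  by (induction n) (simp_all add: Suc_choose_two algebra_simps)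

text \<open>Identifies the terms of the \<open>q\<close>-binomial theorem at
  \<open>z / q ^ n\<close> with theta terms. The factor depending on \<open>n\<close> alone is the
  reciprocal of the one in \<open>qpochhammer_shift\<close>, so the two cancel.\<close>

lemma theta_term_diff:
  assumes "z \<noteq> 0" "q \<noteq> 0"
  shows "theta_term z q (int k - int n) =
           q ^ (Suc n choose 2) / z ^ n * (q ^ (k choose 2) * (z / q ^ n) ^ k)"
proof -
  have "(int k - int n) * (int k - int n - 1) =
      2 * (int (k choose 2) + int (Suc n choose 2) - int (n * k))"
    by (simp add: right_diff_distrib distrib_left two_times_choose_two) (simp add: algebra_simps)
  hence eq: "(int k - int n) * (int k - int n - 1) div 2 =
      int (k choose 2) + int (Suc n choose 2) - int (n * k)"
    by simp
  have "theta_term z q (int k - int n) =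
      z ^ k / z ^ n * (q ^ (k choose 2) * q ^ (Suc n choose 2) / q ^ (n * k))"
    using assms by (simp only: theta_term_def eq power_int_diff power_int_add power_int_of_nat simp_thms)
  thus ?thesis
    by (simp add: power_divide power_mult)
qed

lemma finite_triple_product:
  assumes "z \<noteq> 0" "q \<noteq> 0" "norm q < 1"
  shows "qpochhammer (- z) q n * qpochhammer (- (q / z)) q n =
           (\<Sum>m\<in>{- int n..int n}. qbinomial q (2 * n) (nat (int n + m)) * theta_term z q m)"
proof -
  \<comment> \<open>the \<open>q\<close>-binomial theorem with \<open>2 * n\<close> factors, evaluated at \<open>z / q ^ n\<close>\<close>
  define c where "c = q ^ (Suc n choose 2) / z ^ n"
  have "qpochhammer (- z) q n * qpochhammer (- (q / z)) q n = c * qpochhammer (- (z / q ^ n)) q (2 * n)"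
    using qpochhammer_shift[OF assms(1,2), of n n] assms by (simp add: c_def mult_2)
  also have "\<dots> = (\<Sum>k\<le>2 * n. qbinomial q (2 * n) k * theta_term z q (int k - int n))"
    unfolding q_binomial_theorem[OF assms(3)] theta_term_diff[OF assms(1,2)] sum_distrib_left c_def
    by (simp add: mult_ac)
  also have "\<dots> = (\<Sum>m\<in>{- int n..int n}. qbinomial q (2 * n) (nat (int n + m)) * theta_term z q m)"
    by (rule sum.reindex_bij_witness[of _ "\<lambda>m. nat (int n + m)" "\<lambda>k. int k - int n"]) auto
  finally show ?thesis .
qed

text \<open>The limit of \<open>finite_triple_product\<close>: for fixed \<open>m\<close> all three
  indices in the Gaussian coefficient grow, so it tends to
  \<open>L / (L * L) = 1 / L\<close>.\<close>

theorem jacobi_triple_product: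
  assumes "z \<noteq> 0" "q \<noteq> 0" "norm q < 1"
  shows "(\<Sum>\<^sub>\<infinity>n. theta_term z q n) =
           qpochhammer_inf q q * qpochhammer_inf (- z) q * qpochhammer_inf (- (q / z)) q"
proof -
  define L where "L = qpochhammer_inf q q"
  have L: "L \<noteq> 0" "qpochhammer q q \<longlonglongrightarrow> L"
    using assms(3) by (simp_all add: L_def qpochhammer_inf_self_nonzero qpochhammer_tendsto)
  \<comment> \<open>Extension by zero lets all the finite sums range over the integers, as
    \<open>tendsto_infsum_int\<close> requires.\<close>
  define f where "f = (\<lambda>n m. if m \<in> {- int n..int n}
      then qbinomial q (2 * n) (nat (int n + m)) * theta_term z q m else 0)"
  have sum_f: "(\<Sum>\<^sub>\<infinity>m. f n m) = qpochhammer (- z) q n * qpochhammer (- (q / z)) q n" for n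
  proof -
    have "(\<Sum>\<^sub>\<infinity>m. f n m) = (\<Sum>\<^sub>\<infinity>m\<in>{- int n..int n}. f n m)"
      by (rule infsum_cong_neutral) (auto simp: f_def)
    thus ?thesis
      by (simp add: finite_triple_product[OF assms] f_def)
  qed
  \<comment> \<open>Since \<open>L \<noteq> 0\<close>, both the finite products and their
    reciprocals converge, hence are bounded. This bounds all Gaussian coefficients uniformly and
    makes a multiple of the theta series a majorant.\<close>
  obtain K where K: "\<And>n. norm (qpochhammer q q n) \<le> K"
    using L(2) by (meson BseqE convergentI convergent_imp_Bseq)
  have "(\<lambda>n. inverse (qpochhammer q q n)) \<longlonglongrightarrow> inverse L"
    by (intro tendsto_inverse L)
  then obtain K' where K': "\<And>n. norm (inverse (qpochhammer q q n)) \<le> K'"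
    by (meson BseqE convergentI convergent_imp_Bseq)
  have K_nonneg: "0 \<le> K" "0 \<le> K'"
    using K[of 0] K'[of 0] by (auto intro: order_trans[OF norm_ge_zero])
  have qbinomial_le: "norm (qbinomial q n k) \<le> K * (K' * K')" for n k
    unfolding qbinomial_def divide_inverse inverse_mult_distrib norm_mult
    by (intro mult_mono K K' mult_nonneg_nonneg norm_ge_zero K_nonneg)
  have "(\<lambda>n. \<Sum>\<^sub>\<infinity>m. f n m) \<longlonglongrightarrow> (\<Sum>\<^sub>\<infinity>m. inverse L * theta_term z q m)"
  proof (rule tendsto_infsum_int)
    fix m :: int
    have sub: "filterlim (\<lambda>n. nat (int n + j)) sequentially sequentially" for j
      unfolding filterlim_at_top eventually_at_top_linorder
    proof
      fix Z
      show "\<exists>N. \<forall>n\<ge>N. Z \<le> nat (int n + j)"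
        by (rule exI[of _ "nat (int Z - j)"]) auto
    qed
    have "filterlim (\<lambda>n::nat. 2 * n) sequentially sequentially"
      by (intro mult_nat_left_at_top) auto
    hence "(\<lambda>n. qpochhammer q q (2 * n) / (qpochhammer q q (nat (int n + m)) *
        qpochhammer q q (nat (int n + - m))) * theta_term z q m) \<longlonglongrightarrow> L / (L * L) * theta_term z q m"
      using L(1) by (intro tendsto_intros filterlim_compose[OF L(2)] sub) auto
    moreover have "eventually (\<lambda>n. qpochhammer q q (2 * n) / (qpochhammer q q (nat (int n + m)) *
        qpochhammer q q (nat (int n + - m))) * theta_term z q m = f n m) sequentially"
      using eventually_ge_at_top[of "nat \<bar>m\<bar>"]
    proof eventually_elim
      case (elim n)
      hence "2 * n - nat (int n + m) = nat (int n + - m)"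
        by (simp add: nat_le_iff)
      moreover have "m \<in> {- int n..int n}"
        using elim by auto
      ultimately show ?case
        by (simp add: f_def qbinomial_def)
    qed
    ultimately show "(\<lambda>n. f n m) \<longlonglongrightarrow> inverse L * theta_term z q m"
      using L(1) by (simp add: tendsto_cong field_simps)
  next
    show "norm (f n m) \<le> K * (K' * K') * norm (theta_term z q m)" for n m
      using qbinomial_le K_nonneg by (simp add: f_def norm_mult mult_right_mono)
    show "(\<lambda>m. K * (K' * K') * norm (theta_term z q m)) summable_on UNIV"
      by (intro summable_on_cmult_right theta_term_abs_summable assms)
  qed
  moreover have "(\<lambda>n. \<Sum>\<^sub>\<infinity>m. f n m) \<longlonglongrightarrow> qpochhammer_inf (- z) q * qpochhammer_inf (- (q / z)) q"
    unfolding sum_f by (intro tendsto_mult qpochhammer_tendsto assms)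
  ultimately have "(\<Sum>\<^sub>\<infinity>m. inverse L * theta_term z q m) =
      qpochhammer_inf (- z) q * qpochhammer_inf (- (q / z)) q"
    by (rule LIMSEQ_unique)
  thus ?thesis
    unfolding infsum_cmult_right' L_def[symmetric] using L(1) by (simp add: field_simps)
qed

subsection \<open>Dissection by fifth roots of unity\<close>

lemma primitive_fifth_root_sum:
  fixes \<omega> :: "'a :: idom"
  assumes "\<omega> ^ 5 = 1" "\<omega> \<noteq> 1"
  shows "1 + \<omega> + \<omega> ^ 2 + \<omega> ^ 3 + \<omega> ^ 4 = 0"
proof -
  have "(\<omega> - 1) * (1 + \<omega> + \<omega> ^ 2 + \<omega> ^ 3 + \<omega> ^ 4) = \<omega> ^ 5 - 1"
    by algebra
  thus ?thesis
    using assms by simp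
qed

text \<open>The factors for \<open>j\<close> and \<open>5 - j\<close> are paired. The resulting
  quadratics have middle coefficients built from \<open>\<omega> + \<omega>^4\<close> and
  \<open>\<omega>^2 + \<omega>^3 = - (1 + \<omega> + \<omega>^4)\<close>, which have sum
  \<open>-1\<close> and product \<open>-1\<close>.\<close>

lemma prod_primitive_fifth_root:
  fixes \<omega> x y :: "'a :: idom"
  assumes "\<omega> ^ 5 = 1" "\<omega> \<noteq> 1"
  shows "(\<Prod>j<5. x - \<omega> ^ j * y) = x ^ 5 - y ^ 5"
proof -
  have "(x - \<omega> * y) * (x - \<omega> ^ 4 * y) = x ^ 2 - (\<omega> + \<omega> ^ 4) * x * y + y ^ 2"
    using assms(1) by algebra
  moreover have "(x - \<omega> ^ 2 * y) * (x - \<omega> ^ 3 * y) = x ^ 2 + (1 + \<omega> + \<omega> ^ 4) * x * y + y ^ 2"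
    using assms(1) primitive_fifth_root_sum[OF assms] by algebra
  moreover have "(\<omega> + \<omega> ^ 4) * (1 + \<omega> + \<omega> ^ 4) = 1"
    using assms(1) primitive_fifth_root_sum[OF assms] by algebra
  ultimately have "(x - y) * ((x - \<omega> * y) * (x - \<omega> ^ 4 * y)) * ((x - \<omega> ^ 2 * y) * (x - \<omega> ^ 3 * y))
      = x ^ 5 - y ^ 5"
    by algebra
  thus ?thesis
    by (simp add: eval_nat_numeral mult_ac)
qed

lemma primitive_fifth_root_power:
  fixes \<omega> :: "'a :: idom"
  assumes "\<omega> ^ 5 = 1" "\<omega> \<noteq> 1" "\<not> 5 dvd k"
  shows "\<omega> ^ k \<noteq> 1"
proof -
  have "\<omega> ^ k = (\<omega> ^ 5) ^ (k div 5) * \<omega> ^ (k mod 5)"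
    by (simp flip: power_mult power_add)
  hence k: "\<omega> ^ k = \<omega> ^ (k mod 5)"
    by (simp add: assms)
  have "k mod 5 < 5" "k mod 5 \<noteq> 0"
    using assms(3) by (auto simp: dvd_eq_mod_eq_0)
  hence "k mod 5 \<in> {1, 2, 3, 4}"
    by auto
  moreover have "\<omega> ^ 2 \<noteq> 1" "\<omega> ^ 3 \<noteq> 1" "\<omega> ^ 4 \<noteq> 1"
    using assms(1,2) by algebra+
  ultimately show ?thesis
    using assms(2) unfolding k by auto
qed

text \<open>Each induction step adds five consecutive exponents, exactly one of them a multiple of
  \<open>5\<close>. The other four give factors free of \<open>x\<close> because
  \<open>x ^ 5 = 1\<close>; the product in \<open>p ^ 25\<close> supplies the factors that they miss
  in \<open>qpochhammer (p ^ 5) (p ^ 5) (5 * n)\<close>.\<close>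

lemma finite_fifth_root_dissection:
  assumes \<omega>: "\<omega> ^ 5 = 1" "\<omega> \<noteq> 1" and x: "x ^ 5 = 1"
  shows "(\<Prod>j<5. qpochhammer (x * (\<omega> ^ j * p)) (\<omega> ^ j * p) (5 * n)) * qpochhammer (p ^ 25) (p ^ 25) n =
           qpochhammer (p ^ 5) (p ^ 5) (5 * n) * qpochhammer (x * p ^ 5) (p ^ 5) n ^ 5"
proof (induction n)
  case (Suc n)
  \<comment> \<open>\<open>qpochhammer\<close> counts its factors from \<open>0\<close>, so \<open>F k\<close> carries the power \<open>p ^ Suc k\<close>.\<close>
  define F where "F = (\<lambda>k. \<Prod>j<5. 1 - x * (\<omega> ^ j * p) * (\<omega> ^ j * p) ^ k)"
  have F: "F k = (\<Prod>j<5. 1 - (\<omega> ^ Suc k) ^ j * (x * p ^ Suc k))" for k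
    unfolding F_def by (simp add: power_mult_distrib mult_ac flip: power_mult)
  have coprime: "F k = 1 - p ^ 5 * (p ^ 5) ^ k" if "\<not> 5 dvd Suc k" for k
  proof -
    have "(\<omega> ^ Suc k) ^ 5 = (\<omega> ^ 5) ^ Suc k"
      by (simp only: mult.commute flip: power_mult)
    hence "(\<omega> ^ Suc k) ^ 5 = 1"
      by (simp add: \<omega>)
    hence "F k = 1 - x ^ 5 * (p ^ Suc k) ^ 5"
      using prod_primitive_fifth_root[OF _ primitive_fifth_root_power[OF \<omega> that], of 1 "x * p ^ Suc k"]
      by (simp only: F power_mult_distrib power_one)
    thus ?thesis
      by (simp add: x power_mult_distrib flip: power_mult) (simp add: mult.commute)
  qed
  have multiple: "F (5 * n + 4) = (1 - x * p ^ 5 * (p ^ 5) ^ n) ^ 5"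
  proof -
    have "Suc (5 * n + 4) = 5 * Suc n"
      by simp
    thus ?thesis
      unfolding F by (simp only: power_mult \<omega>) (simp add: mult_ac)
  qed
  have expand: "qpochhammer a b (5 * Suc n) = qpochhammer a b (5 * n) * (1 - a * b ^ (5 * n)) *
      (1 - a * b ^ (5 * n + 1)) * (1 - a * b ^ (5 * n + 2)) * (1 - a * b ^ (5 * n + 3)) * (1 - a * b ^ (5 * n + 4))" for a b
  proof -
    have "5 * Suc n = Suc (Suc (Suc (Suc (Suc (5 * n)))))"
      by simp
    thus ?thesis
      by (simp only: qpochhammer_Suc) (simp add: eval_nat_numeral)
  qed
  have lhs: "(\<Prod>j<5. qpochhammer (x * (\<omega> ^ j * p)) (\<omega> ^ j * p) (5 * Suc n)) =
      (\<Prod>j<5. qpochhammer (x * (\<omega> ^ j * p)) (\<omega> ^ j * p) (5 * n)) *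
      F (5 * n) * F (5 * n + 1) * F (5 * n + 2) * F (5 * n + 3) * F (5 * n + 4)"
    unfolding expand prod.distrib F_def by simp
  have F_coprime: "F (5 * n) = 1 - p ^ 5 * (p ^ 5) ^ (5 * n)"
    "F (5 * n + 1) = 1 - p ^ 5 * (p ^ 5) ^ (5 * n + 1)"
    "F (5 * n + 2) = 1 - p ^ 5 * (p ^ 5) ^ (5 * n + 2)"
    "F (5 * n + 3) = 1 - p ^ 5 * (p ^ 5) ^ (5 * n + 3)"
    by (rule coprime, presburger)+
  have last: "p ^ 5 * (p ^ 5) ^ (5 * n + 4) = p ^ 25 * (p ^ 25) ^ n"
    by (simp add: power_add flip: power_mult)
  \<comment> \<open>Here \<open>w\<close> is the fifth power contributed by the multiple of
    \<open>5\<close>, and \<open>e\<close> is the new factor \<open>1 - p^(25(n+1))\<close>, which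
    appears on both sides.\<close>
  have rearrange: "a * c0 * c1 * c2 * c3 * w * (b * e) = c * c0 * c1 * c2 * c3 * e * (d * w)"
    if "a * b = c * d" for a b c d e w c0 c1 c2 c3 :: complex
  proof -
    have "a * c0 * c1 * c2 * c3 * w * (b * e) = (a * b) * (c0 * c1 * c2 * c3 * e * w)"
      by (simp only: mult_ac)
    thus ?thesis
      unfolding that by (simp only: mult_ac)
  qed
  show ?case
    unfolding lhs F_coprime multiple expand[of "p ^ 5" "p ^ 5"] last qpochhammer_Suc[of _ _ n]
      power_mult_distrib[of "qpochhammer _ _ _"]
    by (rule rearrange[OF Suc.IH])
qed simp

lemma norm_root_unity:
  fixes \<omega> :: "'a :: real_normed_div_algebra"
  assumes "\<omega> ^ n = 1" "n > 0"
  shows "norm \<omega> = 1"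
  by (rule power_eq_imp_eq_base[of _ n]) (use assms in \<open>simp_all flip: norm_power\<close>)

lemma fifth_root_dissection:
  assumes \<omega>: "\<omega> ^ 5 = 1" "\<omega> \<noteq> 1" and x: "x ^ 5 = 1" and p: "norm p < 1"
  shows "(\<Prod>j<5. qpochhammer_inf (x * (\<omega> ^ j * p)) (\<omega> ^ j * p)) * qpochhammer_inf (p ^ 25) (p ^ 25) =
           qpochhammer_inf (p ^ 5) (p ^ 5) * qpochhammer_inf (x * p ^ 5) (p ^ 5) ^ 5"
proof (rule LIMSEQ_unique)
  have small: "norm (\<omega> ^ j * p) < 1" for j
    using p norm_root_unity[OF \<omega>(1)] by (simp add: norm_mult norm_power)
  have small_power: "norm (p ^ 5) < 1" "norm (p ^ 25) < 1"
    using power_Suc_norm_less_1[OF p, of 4] power_Suc_norm_less_1[OF p, of 24] by simp_all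
  have times5: "filterlim (\<lambda>n::nat. 5 * n) sequentially sequentially"
    by (intro mult_nat_left_at_top) auto
  show "(\<lambda>n. (\<Prod>j<5. qpochhammer (x * (\<omega> ^ j * p)) (\<omega> ^ j * p) (5 * n)) * qpochhammer (p ^ 25) (p ^ 25) n)
      \<longlonglongrightarrow> (\<Prod>j<5. qpochhammer_inf (x * (\<omega> ^ j * p)) (\<omega> ^ j * p)) * qpochhammer_inf (p ^ 25) (p ^ 25)"
    by (intro tendsto_intros filterlim_compose[OF qpochhammer_tendsto times5] qpochhammer_tendsto
        small small_power)
  show "(\<lambda>n. (\<Prod>j<5. qpochhammer (x * (\<omega> ^ j * p)) (\<omega> ^ j * p) (5 * n)) * qpochhammer (p ^ 25) (p ^ 25) n)
      \<longlonglongrightarrow> qpochhammer_inf (p ^ 5) (p ^ 5) * qpochhammer_inf (x * p ^ 5) (p ^ 5) ^ 5"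
    unfolding finite_fifth_root_dissection[OF \<omega> x]
    by (intro tendsto_intros filterlim_compose[OF qpochhammer_tendsto times5] qpochhammer_tendsto
        small_power)
qed

section \<open>Fractional powers of \<open>q\<close> and the translation of \<tau> by
  \<open>1\<close>\<close>

lemma q_power_add: "q_power \<tau> (r + s) = q_power \<tau> r * q_power \<tau> s"
  by (simp add: q_power_def algebra_simps exp_add)

lemma q_power_mult: "q_power (of_real c * \<tau>) r = q_power \<tau> (c * r)"
  by (simp add: q_power_def mult_ac)

lemma q_power_power: "q_power \<tau> r ^ n = q_power \<tau> (of_nat n * r)"
  by (simp add: q_power_def mult_ac flip: exp_of_nat_mult)

lemma q_power_powi: "q_power \<tau> r powi n = q_power \<tau> (of_int n * r)"
  by (simp add: q_power_def mult_ac exp_power_int)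

lemma q_power_nonzero: "q_power \<tau> r \<noteq> 0"
  by (simp add: q_power_def)

lemma norm_q_power_less_1:
  assumes "Im \<tau> > 0" "r > 0"
  shows "norm (q_power \<tau> r) < 1"
  using assms by (simp add: q_power_def)

lemma q_power_plus_int:
  assumes "r \<in> \<int>"
  shows "q_power (\<tau> + 1) r = q_power \<tau> r"
proof -
  obtain n where "r = of_int n"
    using assms by (auto elim: Ints_cases)
  thus ?thesis
    using exp_integer_2pi[of "of_int n"] by (simp add: q_power_def distrib_left exp_add mult_ac)
qed

lemma half_even_in_Ints: "even n \<Longrightarrow> (of_int n / 2 :: 'a :: field_char_0) \<in> \<int>"
  by (auto elim!: evenE)

text \<open>All exponents in the series are integers, because \<open>5 * n ^ 2 - n\<close> is
  even.\<close>

lemma theta_B_plus_1: "theta_B (\<tau> + 1) = theta_B \<tau>"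
proof -
  have "q_power (\<tau> + 1) ((5 * of_int n ^ 2 - of_int n) / 2) = q_power \<tau> ((5 * of_int n ^ 2 - of_int n) / 2)" for n
    using half_even_in_Ints[of "5 * n ^ 2 - n", where 'a = real] by (intro q_power_plus_int) simp
  thus ?thesis
    by (simp add: theta_B_def q_power_plus_int)
qed

text \<open>Only the prefactor \<open>q\<close> to the power \<open>1/5\<close> sees the
  translation.\<close>

lemma theta_A_plus_1: "theta_A (\<tau> + 1) = exp (2 * of_real pi * \<i> / 5) * theta_A \<tau>"
proof -
  have "q_power (\<tau> + 1) ((5 * of_int n ^ 2 - 3 * of_int n) / 2) =
      q_power \<tau> ((5 * of_int n ^ 2 - 3 * of_int n) / 2)" for n
    using half_even_in_Ints[of "5 * n ^ 2 - 3 * n", where 'a = real] by (intro q_power_plus_int) simp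
  moreover have "q_power (\<tau> + 1) (1 / 5) = exp (2 * of_real pi * \<i> / 5) * q_power \<tau> (1 / 5)"
    by (simp add: q_power_def distrib_left exp_add add_divide_distrib mult_ac)
  ultimately show ?thesis
    by (simp add: theta_A_def q_power_plus_int mult_ac)
qed

text \<open>The representatives \<open>-1\<close> to \<open>3\<close> suit the symmetry
  \<open>n \<mapsto> 1 - n\<close> of \<open>n * (n - 1)\<close>: it exchanges the classes of
  \<open>0\<close> and \<open>1\<close> and those of \<open>-1\<close> and \<open>2\<close>, and
  fixes that of \<open>3\<close>.\<close>

lemma infsum_residue_classes:
  fixes f :: "int \<Rightarrow> 'a :: banach"
  assumes "f summable_on UNIV"
  shows "infsum f UNIV = (\<Sum>r\<in>{- 1..3}. \<Sum>\<^sub>\<infinity>m. f (5 * m + r))"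
proof -
  have bij: "bij_betw (\<lambda>(r, m). 5 * m + r) ({- 1..3} \<times> UNIV) (UNIV :: int set)"
    by (rule bij_betw_byWitness[of _ "\<lambda>n. ((n + 1) mod 5 - 1, (n + 1) div 5)"]) (auto, presburger+)
  have "(\<lambda>(r, m). f (5 * m + r)) summable_on {- 1..3} \<times> UNIV"
    using summable_on_reindex_bij_betw[OF bij, of f] assms by (simp add: case_prod_unfold)
  from infsum_Sigma_banach[OF this] show ?thesis
    using infsum_reindex_bij_betw[OF bij, of f] by (simp add: case_prod_unfold)
qed

lemma infsum_int_uminus: "(\<Sum>\<^sub>\<infinity>n::int. f (- n)) = infsum f UNIV"
  by (rule infsum_reindex_bij_betw) (rule bij_uminus)

subsection \<open>Quintic theta functions\<close>

definition quintic_theta :: "complex \<Rightarrow> complex \<Rightarrow> complex" where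
  "quintic_theta \<zeta> \<tau> = euler_powr (q_power \<tau> 5) (-3/5) / (1 + \<zeta>) *
     (\<Sum>\<^sub>\<infinity>n. \<zeta> powi n * q_power \<tau> ((of_int n ^ 2 - of_int n) / 2))"

lemma theta_C_eq_quintic_theta: "theta_C = quintic_theta (exp (3 * of_real pi * \<i> / 5))"
  by (rule ext) (simp add: theta_C_def quintic_theta_def exp_power_int mult_ac)

lemma theta_D_eq_quintic_theta: "theta_D = quintic_theta (exp (of_real pi * \<i> / 5))"
  by (rule ext) (simp add: theta_D_def quintic_theta_def exp_power_int mult_ac)

lemma theta_term_q_power:
  "theta_term \<zeta> (q_power \<tau> 1) n = \<zeta> powi n * q_power \<tau> ((of_int n ^ 2 - of_int n) / 2)"
proof -
  have "even (n * (n - 1))"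
    by simp
  hence "real_of_int (n * (n - 1) div 2) = (of_int n ^ 2 - of_int n) / 2"
    by (subst real_of_int_div) (simp_all add: power2_eq_square algebra_simps)
  thus ?thesis
    by (simp only: theta_term_def q_power_powi mult_1_right)
qed

text \<open>The triple product at \<open>z = \<zeta>\<close>, with its first factor
  \<open>1 + \<zeta>\<close> cancelled by the denominator. The remaining products have the form
  required by \<open>fifth_root_dissection\<close>, with \<open>x\<close> equal to \<open>1\<close>,
  \<open>- \<zeta>\<close> and \<open>- 1 / \<zeta>\<close>.\<close>

lemma quintic_theta_product:
  assumes "Im \<tau> > 0" "\<zeta> \<noteq> 0" "\<zeta> \<noteq> - 1" "q = q_power \<tau> 1"
  shows "quintic_theta \<zeta> \<tau> = euler_powr (q_power \<tau> 5) (-3/5) * qpochhammer_inf q q *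
           qpochhammer_inf (- \<zeta> * q) q * qpochhammer_inf (- (1 / \<zeta>) * q) q"
proof -
  have q: "q \<noteq> 0" "norm q < 1"
    using assms by (simp_all add: q_power_nonzero norm_q_power_less_1)
  have "1 + \<zeta> \<noteq> 0"
    using assms(3) by (simp add: add_eq_0_iff)
  thus ?thesis
    using jacobi_triple_product[OF assms(2) q] qpochhammer_inf_rec[OF q(2), of "- \<zeta>"]
    unfolding quintic_theta_def assms(4) theta_term_q_power by (simp add: field_simps)
qed

text \<open>As \<open>\<zeta> ^ 5 = - 1\<close>, the classes of \<open>0\<close> and
  \<open>1\<close> give \<open>1 + \<zeta>\<close> times the series of \<open>B\<close>, and those
  of \<open>-1\<close> and \<open>2\<close> give \<open>1 / \<zeta> + \<zeta> ^ 2\<close> times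
  \<open>q\<close> times the series of \<open>A\<close>.\<close>

lemma quintic_theta_dissection:
  assumes "Im \<tau> > 0" "\<zeta> ^ 5 = - 1" "\<zeta> \<noteq> - 1"
  shows "quintic_theta \<zeta> \<tau> = theta_B (5 * \<tau>) + (\<zeta> + 1 / \<zeta> - 1) * theta_A (5 * \<tau>)"
proof -
  define q where "q = q_power \<tau> 1"
  define A where "A = (\<lambda>n::int. (-1) powi n * q_power (5 * \<tau>) ((5 * of_int n ^ 2 - 3 * of_int n) / 2))"
  define B where "B = (\<lambda>n::int. (-1) powi n * q_power (5 * \<tau>) ((5 * of_int n ^ 2 - of_int n) / 2))"
  define f where "f = (\<lambda>n::int. \<zeta> powi n * q_power \<tau> ((of_int n ^ 2 - of_int n) / 2))"
  have nz: "\<zeta> \<noteq> 0" "1 + \<zeta> \<noteq> 0"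
    using assms(2,3) by (auto simp: add_eq_0_iff)
  have "f summable_on UNIV"
    using theta_term_abs_summable[OF nz(1), of q] norm_q_power_less_1[OF assms(1)]
    by (auto simp: q_def f_def theta_term_q_power q_power_nonzero intro: abs_summable_summable)
  hence "infsum f UNIV = (\<Sum>r\<in>{- 1..3}. \<Sum>\<^sub>\<infinity>m. f (5 * m + r))"
    by (rule infsum_residue_classes)
  also have "{- 1..3} = {- 1, 0, 1, 2, 3 :: int}"
    by auto
  finally have sum_f: "infsum f UNIV = (\<Sum>\<^sub>\<infinity>m. f (5 * m - 1)) + (\<Sum>\<^sub>\<infinity>m. f (5 * m)) +
      (\<Sum>\<^sub>\<infinity>m. f (5 * m + 1)) + (\<Sum>\<^sub>\<infinity>m. f (5 * m + 2)) + (\<Sum>\<^sub>\<infinity>m. f (5 * m + 3))"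
    by simp
  have \<zeta>_powi: "\<zeta> powi (5 * m + r) = (-1) powi m * \<zeta> powi r" for m r
    using nz by (simp add: power_int_add power_int_mult assms(2))
  have f_eq: "f (5 * m + r) = \<zeta> powi r * (-1) powi m * q_power \<tau> e"
    if "e = ((5 * of_int m + of_int r) ^ 2 - (5 * of_int m + of_int r)) / 2" for m r e
    unfolding that f_def \<zeta>_powi by simp
  have five: "q_power (5 * \<tau>) r = q_power \<tau> (5 * r)" for r
    using q_power_mult[of 5 \<tau> r] by simp
  \<comment> \<open>The surplus exponent \<open>1\<close> in the classes of \<open>-1\<close> and
    \<open>2\<close> is the prefactor of \<open>A\<close> at \<open>5 * \<tau>\<close>.\<close>
  have shift: "q * q_power (5 * \<tau>) r = q_power \<tau> (1 + 5 * r)" for r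
    by (simp add: q_def five q_power_add)
  have minus_powi: "(-1) powi (- m) = ((-1) powi m :: complex)" for m :: int
    by (simp add: power_int_minus flip: power_int_inverse)
  have "f (5 * m + (- 1)) = \<zeta> powi (- 1) * (-1) powi m *
      q_power \<tau> (1 + 5 * ((5 * of_int m ^ 2 - 3 * of_int m) / 2))" for m
    by (rule f_eq) (simp add: field_simps power2_eq_square)
  hence f_m1: "f (5 * m - 1) = 1 / \<zeta> * q * A m" for m
    unfolding A_def shift[symmetric] by (simp add: power_int_minus inverse_eq_divide)
  have "f (5 * m + 0) = \<zeta> powi 0 * (-1) powi m *
      q_power \<tau> (5 * ((5 * of_int m ^ 2 - of_int m) / 2))" for m
    by (rule f_eq) (simp add: field_simps power2_eq_square)
  hence f_0: "f (5 * m) = B m" for m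
    unfolding B_def five by simp
  have "f (5 * m + 1) = \<zeta> powi 1 * (-1) powi m *
      q_power \<tau> (5 * ((5 * of_int (- m) ^ 2 - of_int (- m)) / 2))" for m
    by (rule f_eq) (simp add: field_simps power2_eq_square)
  hence f_1: "f (5 * m + 1) = \<zeta> * B (- m)" for m
    unfolding B_def five minus_powi by (simp add: mult_ac)
  have "f (5 * m + 2) = \<zeta> powi 2 * (-1) powi m *
      q_power \<tau> (1 + 5 * ((5 * of_int (- m) ^ 2 - 3 * of_int (- m)) / 2))" for m
    by (rule f_eq) (simp add: field_simps power2_eq_square)
  hence f_2: "f (5 * m + 2) = \<zeta> ^ 2 * q * A (- m)" for m
    unfolding A_def shift[symmetric] minus_powi by (simp add: mult_ac)
  \<comment> \<open>This class cancels: its terms are odd under \<open>m \<mapsto> - 1 - m\<close>.\<close>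
  have f_3: "(\<Sum>\<^sub>\<infinity>m. f (5 * m + 3)) = 0"
  proof -
    have odd: "f (5 * (- 1 - m) + 3) = - f (5 * m + 3)" for m
    proof -
      have "(-1) powi (- 1 - m) = (- ((-1) powi m) :: complex)"
        using minus_powi[of m] by (simp add: power_int_diff power_int_minus divide_inverse)
      moreover have "((5 * of_int (- 1 - m) + of_int 3) ^ 2 - (5 * of_int (- 1 - m) + of_int 3)) / 2 =
          ((5 * of_int m + of_int 3) ^ 2 - (5 * of_int m + of_int 3)) / (2 :: real)"
        by (simp add: field_simps power2_eq_square)
      ultimately show ?thesis
        by (simp only: f_eq[OF refl]) simp
    qed
    have "bij (\<lambda>m::int. - 1 - m)"
      by (rule bij_betw_byWitness[of _ "\<lambda>m. - 1 - m"]) auto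
    from infsum_reindex_bij_betw[OF this, of "\<lambda>m. f (5 * m + 3)"]
    have "(\<Sum>\<^sub>\<infinity>m. f (5 * m + 3)) = - (\<Sum>\<^sub>\<infinity>m. f (5 * m + 3))"
      unfolding odd infsum_uminus by simp
    thus ?thesis
      by simp
  qed
  have "infsum f UNIV = (1 + \<zeta>) * infsum B UNIV + (1 / \<zeta> + \<zeta> ^ 2) * q * infsum A UNIV"
    unfolding sum_f f_m1 f_0 f_1 f_2 f_3
    by (simp only: infsum_cmult_right' infsum_int_uminus[of A] infsum_int_uminus[of B]) (simp add: algebra_simps)
  \<comment> \<open>This is \<open>1 + \<zeta>^3 = (1 + \<zeta>) * (1 - \<zeta> + \<zeta>^2)\<close>
    divided by \<zeta>.\<close>
  also have "1 / \<zeta> + \<zeta> ^ 2 = (1 + \<zeta>) * (\<zeta> + 1 / \<zeta> - 1)"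
    using nz by (simp add: field_simps power2_eq_square)
  finally have "infsum f UNIV / (1 + \<zeta>) = infsum B UNIV + (\<zeta> + 1 / \<zeta> - 1) * q * infsum A UNIV"
    using nz by (simp add: add_divide_distrib)
  moreover have "q_power (5 * \<tau>) 1 = q_power \<tau> 5" "q_power (5 * \<tau>) (1 / 5) = q"
    by (simp_all add: five q_def)
  ultimately show ?thesis
    unfolding quintic_theta_def theta_A_def theta_B_def A_def[symmetric] B_def[symmetric] f_def[symmetric]
    by (simp only: times_divide_eq_left times_divide_eq_right[symmetric]) (simp only: distrib_left mult_ac)
qed

section \<open>The fifth-power identity\<close>

text \<open>In the fifth power the chosen branch becomes the integer power \<open>-3\<close> of the
  Euler product.\<close>

lemma euler_powr_fifth_power:
  assumes "norm q < 1"
  shows "euler_powr q (-3/5) ^ 5 * qpochhammer_inf q q ^ 3 = 1"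
proof -
  have "euler_powr q (-3/5) ^ 5 * exp (log_euler q) ^ 3 = 1"
    unfolding euler_powr_def by (simp flip: exp_of_nat_mult exp_add)
  thus ?thesis
    by (simp add: exp_log_euler[OF assms])
qed

lemma exp_fifth_root:
  "exp (2 * of_real pi * \<i> / 5) ^ 5 = (1 :: complex)" "exp (2 * of_real pi * \<i> / 5) \<noteq> (1 :: complex)"
proof -
  show "exp (2 * of_real pi * \<i> / 5) ^ 5 = (1 :: complex)"
    using exp_two_pi_i by (simp add: mult_ac flip: exp_of_nat_mult)
  show "exp (2 * of_real pi * \<i> / 5) \<noteq> (1 :: complex)"
  proof
    assume "exp (2 * of_real pi * \<i> / 5) = (1 :: complex)"
    then obtain n where "2 * pi / 5 = of_int (2 * n) * pi"
      by (auto simp: exp_eq_1)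
    hence "of_int 1 = (of_int (5 * n) :: real)"
      by (simp add: field_simps)
    hence "1 = 5 * n"
      by (simp only: of_int_eq_iff)
    thus False
      by presburger
  qed
qed

lemma quintic_theta_fifth_power:
  assumes "Im \<tau> > 0" "\<zeta> ^ 5 = - 1" "\<zeta> \<noteq> - 1"
  shows "quintic_theta \<zeta> \<tau> ^ 5 = theta_B \<tau> ^ 5 + (\<zeta> + 1 / \<zeta> - 1) ^ 5 * theta_A \<tau> ^ 5"
proof -
  define \<omega> where "\<omega> = exp (2 * of_real pi * \<i> / 5 :: complex)"
  define p where "p = q_power \<tau> (1 / 5)"
  define q where "q = q_power \<tau> 1"
  define u where "u = \<zeta> + 1 / \<zeta> - 1"
  define P where "P = (\<lambda>x. qpochhammer_inf (x * q) q)"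
  \<comment> \<open>These are the points with \<open>5 * \<sigma> j = \<tau> + j\<close>; their
    nomes \<open>\<omega> ^ j * p\<close> are the five fifth roots of \<open>q\<close>.\<close>
  define \<sigma> where "\<sigma> = (\<lambda>j::nat. (\<tau> + of_nat j) / 5)"
  have \<omega>: "\<omega> ^ 5 = 1" "\<omega> \<noteq> 1"
    unfolding \<omega>_def by (rule exp_fifth_root)+
  have \<zeta>: "\<zeta> \<noteq> 0"
    using assms(2) by auto
  have p: "norm p < 1" "p ^ 5 = q" "p ^ 25 = q ^ 5"
    using assms(1) by (simp_all add: p_def q_def norm_q_power_less_1 q_power_power)
  have q: "norm q < 1" "norm (q ^ 5) < 1" "q_power \<tau> 5 = q ^ 5"
    using assms(1) by (simp_all add: q_def norm_q_power_less_1 q_power_power)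
  have B: "theta_B (\<tau> + of_nat j) = theta_B \<tau>" for j
    by (induction j) (simp_all add: theta_B_plus_1 flip: add.assoc add.commute[of _ 1])
  have A: "theta_A (\<tau> + of_nat j) = \<omega> ^ j * theta_A \<tau>" for j
    by (induction j) (simp_all add: theta_A_plus_1 \<omega>_def flip: add.assoc add.commute[of _ 1])
  have \<sigma>: "Im (\<sigma> j) > 0" "q_power (\<sigma> j) 1 = \<omega> ^ j * p" "q_power (\<sigma> j) 5 = q" for j
  proof -
    show "Im (\<sigma> j) > 0"
      using assms(1) by (simp add: \<sigma>_def)
    show eq: "q_power (\<sigma> j) 1 = \<omega> ^ j * p"
    proof -
      have "2 * of_real pi * \<i> * of_real 1 * \<sigma> j =
          of_nat j * (2 * of_real pi * \<i> / 5) + 2 * of_real pi * \<i> * of_real (1 / 5) * \<tau>"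
        by (simp add: \<sigma>_def field_simps)
      thus ?thesis
        by (simp only: q_power_def \<omega>_def p_def exp_add exp_of_nat_mult)
    qed
    have "q_power (\<sigma> j) 5 = q_power (\<sigma> j) 1 ^ 5"
      by (simp add: q_power_power)
    moreover have "(\<omega> ^ j) ^ 5 = (\<omega> ^ 5) ^ j"
      by (simp only: mult.commute flip: power_mult)
    ultimately show "q_power (\<sigma> j) 5 = q"
      by (simp add: eq power_mult_distrib p \<omega>)
  qed
  have "quintic_theta \<zeta> (\<sigma> j) = theta_B \<tau> - \<omega> ^ j * (- u * theta_A \<tau>)" for j
  proof -
    have "5 * \<sigma> j = \<tau> + of_nat j"
      by (simp add: \<sigma>_def)
    thus ?thesis
      using quintic_theta_dissection[OF \<sigma>(1) assms(2,3), of j] by (simp add: A B flip: u_def)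
  qed
  hence "(\<Prod>j<5. quintic_theta \<zeta> (\<sigma> j)) = theta_B \<tau> ^ 5 - (- u * theta_A \<tau>) ^ 5"
    by (simp only: prod_primitive_fifth_root[OF \<omega>])
  hence lhs: "(\<Prod>j<5. quintic_theta \<zeta> (\<sigma> j)) = theta_B \<tau> ^ 5 + u ^ 5 * theta_A \<tau> ^ 5"
    by (simp add: power_mult_distrib)
  define E where "E = qpochhammer_inf (q ^ 5) (q ^ 5)"
  define R where "R = (\<lambda>x. \<Prod>j<5. qpochhammer_inf (x * (\<omega> ^ j * p)) (\<omega> ^ j * p))"
  \<comment> \<open>Applicable to \<open>1\<close>, \<open>- \<zeta>\<close> and
    \<open>- (1 / \<zeta>)\<close>, which are all fifth roots of unity. Multiplying by
    \<open>E\<close> avoids a denominator; the three copies of \<open>E\<close> cancel at the end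
    against the fifth power of the prefactor of \<open>quintic_theta \<zeta> \<tau>\<close>.\<close>
  have R: "R x * E = P 1 * P x ^ 5" if "x ^ 5 = 1" for x
    using fifth_root_dissection[OF \<omega> that p(1)] by (simp add: R_def E_def P_def p)
  have "quintic_theta \<zeta> (\<sigma> j) = euler_powr q (-3/5) * qpochhammer_inf (1 * (\<omega> ^ j * p)) (\<omega> ^ j * p) *
      qpochhammer_inf (- \<zeta> * (\<omega> ^ j * p)) (\<omega> ^ j * p) *
      qpochhammer_inf (- (1 / \<zeta>) * (\<omega> ^ j * p)) (\<omega> ^ j * p)" for j
    using quintic_theta_product[OF \<sigma>(1) \<zeta> assms(3) refl, of j] unfolding \<sigma> by simp
  hence "(\<Prod>j<5. quintic_theta \<zeta> (\<sigma> j)) = euler_powr q (-3/5) ^ 5 * R 1 * R (- \<zeta>) * R (- (1 / \<zeta>))"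
    by (simp only: R_def prod.distrib) simp
  hence "(\<Prod>j<5. quintic_theta \<zeta> (\<sigma> j)) * E ^ 3 =
      euler_powr q (-3/5) ^ 5 * (R 1 * E) * (R (- \<zeta>) * E) * (R (- (1 / \<zeta>)) * E)"
    by (simp add: power3_eq_cube mult_ac)
  also have "\<dots> = (euler_powr q (-3/5) ^ 5 * P 1 ^ 3) * (P 1 * P (- \<zeta>) * P (- (1 / \<zeta>))) ^ 5"
    using assms(2) by (simp add: R power_divide) (simp add: power_mult_distrib power3_eq_cube mult_ac)
  also have "euler_powr q (-3/5) ^ 5 * P 1 ^ 3 = 1"
    using euler_powr_fifth_power[OF q(1)] by (simp add: P_def)
  finally have prod: "(\<Prod>j<5. quintic_theta \<zeta> (\<sigma> j)) * E ^ 3 = (P 1 * P (- \<zeta>) * P (- (1 / \<zeta>))) ^ 5"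
    by simp
  have "quintic_theta \<zeta> \<tau> = euler_powr (q ^ 5) (-3/5) * (P 1 * P (- \<zeta>) * P (- (1 / \<zeta>)))"
    using quintic_theta_product[OF assms(1) \<zeta> assms(3) q_def] by (simp add: q P_def mult_ac)
  hence "quintic_theta \<zeta> \<tau> ^ 5 = (\<Prod>j<5. quintic_theta \<zeta> (\<sigma> j)) * (euler_powr (q ^ 5) (-3/5) ^ 5 * E ^ 3)"
    using prod by (simp add: power_mult_distrib)
  also have "euler_powr (q ^ 5) (-3/5) ^ 5 * E ^ 3 = 1"
    using euler_powr_fifth_power[OF q(2)] by (simp add: E_def)
  finally show ?thesis
    by (simp add: lhs u_def)
qed

section \<open>The golden ratio as a trace of tenth roots of unity\<close>

text \<open>Here \<open>z = cis \<phi>\<close> is a root of \<open>(z^5 + 1) / (z + 1)\<close>, the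
  tenth cyclotomic polynomial. Dividing that quartic by \<open>z^2\<close> gives
  \<open>x^2 = x + 1\<close> for \<open>x = z + 1 / z\<close>.\<close>

lemma unit_trace_golden:
  fixes \<phi> :: real
  assumes "cis \<phi> ^ 5 = - 1" "cis \<phi> \<noteq> - 1"
  shows "(2 * cos \<phi>) ^ 2 = 2 * cos \<phi> + 1" "cis \<phi> + 1 / cis \<phi> = of_real (2 * cos \<phi>)"
proof -
  show sum: "cis \<phi> + 1 / cis \<phi> = of_real (2 * cos \<phi>)"
    by (simp add: complex_eq_iff inverse_eq_divide[symmetric])
  define z where "z = cis \<phi>"
  have z: "z * (1 / z) = 1"
    by (simp add: z_def)
  have "(z + 1) * (z ^ 4 - z ^ 3 + z ^ 2 - z + 1) = z ^ 5 + 1"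
    by algebra
  hence "z ^ 4 - z ^ 3 + z ^ 2 - z + 1 = 0"
    using assms by (simp add: z_def add_eq_0_iff2)
  hence "(z + 1 / z) ^ 2 = z + 1 / z + 1"
    using z by algebra
  hence "complex_of_real ((2 * cos \<phi>) ^ 2) = of_real (2 * cos \<phi> + 1)"
    unfolding z_def sum by simp
  thus "(2 * cos \<phi>) ^ 2 = 2 * cos \<phi> + 1"
    by (simp only: of_real_eq_iff)
qed

lemma golden_roots:
  fixes x :: real
  assumes "x ^ 2 = x + 1"
  shows "x > 0 \<Longrightarrow> x = (1 + sqrt 5) / 2" "x < 0 \<Longrightarrow> x = (1 - sqrt 5) / 2"
proof -
  have "(2 * x - 1) ^ 2 = 5"
    using assms by algebra
  hence abs: "\<bar>2 * x - 1\<bar> = sqrt 5"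
    by (metis real_sqrt_abs)
  have "sqrt 5 > 1"
    by simp
  moreover have "2 * x - 1 = sqrt 5 \<or> 2 * x - 1 = - sqrt 5"
    using abs by linarith
  ultimately show "x > 0 \<Longrightarrow> x = (1 + sqrt 5) / 2" "x < 0 \<Longrightarrow> x = (1 - sqrt 5) / 2"
    by argo+
qed

theorem theorem1p1:
  fixes \<tau> :: complex and \<alpha> \<beta> :: real
  assumes "Im \<tau> > 0"
    and "\<alpha> = (1 + sqrt 5) / 2"
    and "\<beta> = (1 - sqrt 5) / 2"
  shows "theta_C \<tau> ^ 5 = theta_B \<tau> ^ 5 - of_real \<alpha> ^ 5 * theta_A \<tau> ^ 5 \<and>
         theta_D \<tau> ^ 5 = theta_B \<tau> ^ 5 - of_real \<beta> ^ 5 * theta_A \<tau> ^ 5 \<and>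
         theta_C \<tau> = theta_B (5 * \<tau>) - of_real \<alpha> * theta_A (5 * \<tau>) \<and>
         theta_D \<tau> = theta_B (5 * \<tau>) - of_real \<beta> * theta_A (5 * \<tau>)"
proof -
  define \<phi> \<psi> where "\<phi> = 3 * pi / 5" and "\<psi> = pi / 5"
  have C: "theta_C = quintic_theta (cis \<phi>)" and D: "theta_D = quintic_theta (cis \<psi>)"
    unfolding theta_C_eq_quintic_theta theta_D_eq_quintic_theta
    by (simp_all add: cis_conv_exp \<phi>_def \<psi>_def mult_ac)
  have "cis (3 * pi) = - 1"
    using cis_mult[of "2 * pi" pi] by simp
  hence cis5: "cis \<phi> ^ 5 = - 1" "cis \<psi> ^ 5 = - 1"
    by (simp_all add: Complex.DeMoivre \<phi>_def \<psi>_def)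
  have sin: "sin \<phi> > 0" "sin \<psi> > 0"
    by (auto simp: \<phi>_def \<psi>_def intro!: sin_gt_zero)
  \<comment> \<open>A positive imaginary part excludes the real value \<open>- 1\<close>.\<close>
  have ne: "cis \<phi> \<noteq> - 1" "cis \<psi> \<noteq> - 1"
    using sin by (auto simp: complex_eq_iff)
  \<comment> \<open>This relation crosses the roots: \<open>D\<close> has trace \<alpha> but
    coefficient \<open>\<alpha> - 1 = - \<beta>\<close>, and \<open>C\<close> has trace \<beta> but
    coefficient \<open>- \<alpha>\<close>.\<close>
  have "\<alpha> + \<beta> = 1"
    unfolding assms by (simp add: field_simps)
  hence sum: "complex_of_real \<alpha> + of_real \<beta> = 1"
    by (metis of_real_1 of_real_add)
  have "cos \<psi> > 0"
    by (rule cos_gt_zero_pi) (use pi_gt_zero \<psi>_def in linarith)+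
  hence cos: "2 * cos \<psi> = \<alpha>"
    unfolding assms(2) by (intro golden_roots(1)[OF unit_trace_golden(1)[OF cis5(2) ne(2)]]) simp
  hence \<beta>: "cis \<psi> + 1 / cis \<psi> - 1 = - of_real \<beta>"
    unfolding unit_trace_golden(2)[OF cis5(2) ne(2)] cos using sum by (simp add: algebra_simps)
  \<comment> \<open>The angle \<open>pi - \<phi>\<close> is \<open>2 * pi / 5\<close>, so
    \<open>cos \<phi>\<close> is negative and selects the root \<beta>.\<close>
  have "cos (pi - \<phi>) > 0"
    by (rule cos_gt_zero_pi) (use pi_gt_zero \<phi>_def in linarith)+
  hence cos: "2 * cos \<phi> = \<beta>"
    unfolding assms(3) by (intro golden_roots(2)[OF unit_trace_golden(1)[OF cis5(1) ne(1)]]) simp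
  hence \<alpha>: "cis \<phi> + 1 / cis \<phi> - 1 = - of_real \<alpha>"
    unfolding unit_trace_golden(2)[OF cis5(1) ne(1)] cos using sum by (simp add: algebra_simps)
  show ?thesis
    using quintic_theta_fifth_power[OF assms(1) cis5(1) ne(1)] quintic_theta_fifth_power[OF assms(1) cis5(2) ne(2)]
      quintic_theta_dissection[OF assms(1) cis5(1) ne(1)] quintic_theta_dissection[OF assms(1) cis5(2) ne(2)]
    unfolding C D \<alpha> \<beta> by simp
qed

end
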